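(* Up to $O(1)$ multiplicative factors (absolute constants): 1. for any (possibly partial) Boolean function $f$, $\mathsf{bs}(f)\le\mathrm{deg}^{\mathsf{cert}}(f)^2$; 2. for any total Boolean function $f$, $\mathsf{C}(f)\le\mathrm{deg}^{\mathsf{cert}}(f)^3$.
   Context: A (possibly partial) Boolean function is a map $f:\mathcal{D}\to\{0,1\}$ with $\mathcal{D}\subseteq\{0,1\}^n$; it is total if $\mathcal{D}=\{0,1\}^n$. For $z\in\mathcal{D}$, $f^{\mathsf{cert}}_z$ is the partial function with domain $\{z\}\cup\{y\in\mathcal{D}: f(y)\ne f(z)\}$, with $f^{\mathsf{cert}}_z(z)=1$ and $f^{\mathsf{cert}}_z(y)=0$ whenever $f(y)\neq f(z)$. For a complexity measure $\mathsf{M}$, $\mathsf{M}^{\mathsf{cert}}(f):=\max_{z\in\mathcal{D}}\mathsf{M}(f^{\mathsf{cert}}_z)$. $\mathrm{deg}(f)$ is the minimum degree of a multilinear real polynomial $P$ with $P(x)=f(x)$ for all $x\in\mathcal{D}$ and $P(x)\in[0,1]$ for all $x\in\{0,1\}^n$. Block sensitivity: $\mathsf{bs}(f)=\max_{x\in\mathcal{D}}\mathsf{bs}(f,x)$, where $\mathsf{bs}(f,x)$ is the maximum number $k$ of pairwise disjoint blocks $B_1,\dots,B_k\subseteq[n]$ with $x^{B_j}\in\mathcal{D}$ and $f(x^{B_j})\neq f(x)$ for each $j$ ($x^B$ denotes $x$ with the bits in $B$ flipped). Certificate complexity: $\mathsf{C}(f)=\max_{x\in\mathcal{D}}\mathsf{C}(f,x)$,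 where $\mathsf{C}(f,x)$ is the minimum size of a set $S\subseteq[n]$ such that $f(y)=f(x)$ for every $y\in\mathcal{D}$ agreeing with $x$ on $S$. *)

theory Defs
  imports Complex_Main "HOL-Library.FuncSet"
begin

text \<open>
  The dimension \<open>n\<close> is a natural number and not a type, so that a constant can be chosen
  uniformly in \<open>n\<close>.  Points of the cube are extensional functions on \<open>{..<n}\<close>, the bits 0 and 1
  being \<^term>\<open>False\<close> and \<^term>\<open>True\<close>; a partial Boolean function is a map whose domain lies in
  the cube.
\<close>

definition cube :: "nat \<Rightarrow> (nat \<Rightarrow> bool) set" where
  "cube n = {..<n} \<rightarrow>\<^sub>E (UNIV :: bool set)"

type_synonym boolfun = "(nat \<Rightarrow> bool) \<rightharpoonup> bool"

definition partial_boolfun :: "nat \<Rightarrow> boolfun \<Rightarrow> bool" where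
  "partial_boolfun n f \<longleftrightarrow> dom f \<subseteq> cube n"

definition total_boolfun :: "nat \<Rightarrow> boolfun \<Rightarrow> bool" where
  "total_boolfun n f \<longleftrightarrow> dom f = cube n"

text \<open>
  Below, suprema of sets of natural numbers play the role of maxima of finite sets; on
  \<^typ>\<open>nat\<close> they agree with \<^const>\<open>Max\<close>, except that the supremum of the empty set is 0.  This
  only matters for the function with empty domain and for the degree of the zero polynomial.
\<close>

definition cert_fun :: "boolfun \<Rightarrow> (nat \<Rightarrow> bool) \<Rightarrow> boolfun" where
  "cert_fun f z = (\<lambda>y. if y = z then Some True
                       else if y \<in> dom f \<and> f y \<noteq> f z then Some False
                       else None)"

definition cert_measure :: "(boolfun \<Rightarrow> nat) \<Rightarrow> boolfun \<Rightarrow> nat" where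
  "cert_measure M f = (SUP z\<in>dom f. M (cert_fun f z))"

text \<open>
  A multilinear real polynomial in the variables \<open>x\<^sub>i\<close>, \<open>i < n\<close>, is given by its coefficients:
  \<open>c S\<close> is the coefficient of the monomial \<open>\<Prod>i\<in>S. x\<^sub>i\<close>, for \<open>S \<subseteq> {..<n}\<close>.  Values of \<open>c\<close> on
  other sets are irrelevant.
\<close>

definition ml_eval :: "nat \<Rightarrow> (nat set \<Rightarrow> real) \<Rightarrow> (nat \<Rightarrow> bool) \<Rightarrow> real" where
  "ml_eval n c x = (\<Sum>S\<in>Pow {..<n}. c S * (\<Prod>i\<in>S. of_bool (x i)))"

definition ml_degree :: "nat \<Rightarrow> (nat set \<Rightarrow> real) \<Rightarrow> nat" where
  "ml_degree n c = Sup {card S | S. S \<subseteq> {..<n} \<and> c S \<noteq> 0}"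

definition represents :: "nat \<Rightarrow> (nat set \<Rightarrow> real) \<Rightarrow> boolfun \<Rightarrow> bool" where
  "represents n c f \<longleftrightarrow>
     (\<forall>x\<in>dom f. ml_eval n c x = of_bool (the (f x))) \<and>
     (\<forall>x\<in>cube n. 0 \<le> ml_eval n c x \<and> ml_eval n c x \<le> 1)"

definition bounded_deg :: "nat \<Rightarrow> boolfun \<Rightarrow> nat" where
  "bounded_deg n f = (LEAST d. \<exists>c. represents n c f \<and> ml_degree n c = d)"

definition flip :: "nat set \<Rightarrow> (nat \<Rightarrow> bool) \<Rightarrow> (nat \<Rightarrow> bool)" where
  "flip B x = (\<lambda>i. if i \<in> B then \<not> x i else x i)"

text \<open>
  Blocks at which \<open>f\<close> changes value are nonempty, so pairwise disjoint ones are distinct and a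
  family of \<open>k\<close> blocks is the same as a set of \<open>k\<close> blocks.
\<close>

definition block_sensitivity_at :: "nat \<Rightarrow> boolfun \<Rightarrow> (nat \<Rightarrow> bool) \<Rightarrow> nat" where
  "block_sensitivity_at n f x = Sup {card \<B> | \<B>. \<B> \<subseteq> Pow {..<n} \<and> pairwise disjnt \<B> \<and>
                        (\<forall>B\<in>\<B>. flip B x \<in> dom f \<and> f (flip B x) \<noteq> f x)}"

definition block_sensitivity :: "nat \<Rightarrow> boolfun \<Rightarrow> nat" where
  "block_sensitivity n f = (SUP x\<in>dom f. block_sensitivity_at n f x)"

definition certificate_complexity_at :: "nat \<Rightarrow> boolfun \<Rightarrow> (nat \<Rightarrow> bool) \<Rightarrow> nat" where
  "certificate_complexity_at n f x = (LEAST k. \<exists>S\<subseteq>{..<n}. card S = k \<and>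
                   (\<forall>y\<in>dom f. (\<forall>i\<in>S. y i = x i) \<longrightarrow> f y = f x))"

definition certificate_complexity :: "nat \<Rightarrow> boolfun \<Rightarrow> nat" where
  "certificate_complexity n f = (SUP x\<in>dom f. certificate_complexity_at n f x)"

end

theory Submission
  imports Defs "HOL-Computational_Algebra.Polynomial"
begin

text \<open>
  Let \<open>d\<close> be the certificate degree. The polynomial for the certificate function of \<open>x\<close>,
  restricted to unions of \<open>k\<close> disjoint sensitive blocks of \<open>x\<close> and averaged over all unions of \<open>t\<close>
  of them, becomes a univariate polynomial \<open>p\<close> of degree at most \<open>d\<close> with \<open>p(0) = 1\<close>,
  \<open>p(1) = 0\<close> and \<open>0 \<le> p \<le> 1\<close> on \<open>{0..k}\<close>. For \<open>m = deg p\<close>, the polynomial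
  \<open>q = p / (X - 1)\<close> composed with \<open>6 (X - m)\<^sup>2\<close> has degree below \<open>2 m\<close>, so its alternating
  binomial sum over \<open>{0..2 m}\<close> vanishes. If \<open>6 m\<^sup>2 \<le> k\<close>, all its values off the centre are small
  compared to the central value \<open>q(0) = -1\<close>, which they therefore cannot cancel. Hence
  \<open>k < 6 d\<^sup>2\<close>.

  For total \<open>f\<close>, take a maximal family of disjoint sensitive blocks of \<open>x\<close> of size at most \<open>d\<close>.
  Its union has size at most \<open>6 d\<^sup>3\<close>, and it is a certificate: if \<open>y\<close> agrees with \<open>x\<close> on it but
  \<open>f y \<noteq> f x\<close>, then the polynomial for the certificate function of \<open>y\<close> vanishes at \<open>x\<close> but
  not at \<open>y\<close>. By Moebius inversion a minimal set of coordinates on which changing \<open>x\<close> to \<open>y\<close> makes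
  it nonzero has size at most \<open>d\<close>; by totality this set is a sensitive block, contradicting
  maximality.
\<close>

section \<open>A discrete Markov-type inequality\<close>

text \<open>This is the vanishing of the \<open>n\<close>-th finite difference. Writing p = a + X q,
  the factor i is absorbed by i * C(n+1, i) = (n+1) * C(n, i-1), which leaves the sum of order n for
  q shifted by 1.\<close>

lemma sum_alternating_binomial_poly:
  fixes p :: "real poly"
  assumes "degree p < n"
  shows "(\<Sum>i\<le>n. (-1) ^ i * real (n choose i) * poly p (real i)) = 0"
  using assms
proof (induction n arbitrary: p)
  case 0
  then show ?case by simp
next
  case (Suc n)
  obtain a q where p: "p = pCons a q" by (cases p)
  have const: "(\<Sum>i\<le>Suc n. (-1) ^ i * real (Suc n choose i)) = 0"
    using choose_alternating_sum[of "Suc n", where 'a = real] by simp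
  have "(\<Sum>i\<le>n. (-1) ^ i * real (n choose i) * poly (q \<circ>\<^sub>p [:1, 1:]) (real i)) = 0"
  proof (cases "q = 0")
    case False
    then have "degree (q \<circ>\<^sub>p [:1, 1:]) < n"
      using Suc.prems p by (simp add: degree_pcompose)
    then show ?thesis by (rule Suc.IH)
  qed simp
  then have shift: "(\<Sum>i\<le>n. (-1) ^ i * real (n choose i) * poly q (1 + real i)) = 0"
    by (simp add: poly_pcompose)
  have "(\<Sum>i\<le>Suc n. (-1) ^ i * real (Suc n choose i) * (real i * poly q (real i)))
      = (\<Sum>i\<le>n. (-1) ^ Suc i * real (Suc n choose Suc i) * (real (Suc i) * poly q (real (Suc i))))"
    by (subst sum.atMost_Suc_shift) simp
  also have "\<dots> = (\<Sum>i\<le>n. - real (Suc n) * ((-1) ^ i * real (n choose i) * poly q (1 + real i)))"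
  proof (rule sum.cong[OF refl])
    fix i
    have "real (Suc n choose Suc i) * real (Suc i) = real (Suc n) * real (n choose i)"
      using Suc_times_binomial_eq[of n i] by (metis of_nat_mult)
    then have "(-1) ^ Suc i * (real (Suc n choose Suc i) * real (Suc i)) * poly q (real (Suc i))
      = (-1) ^ Suc i * (real (Suc n) * real (n choose i)) * poly q (real (Suc i))"
      by simp
    then show "(-1) ^ Suc i * real (Suc n choose Suc i) * (real (Suc i) * poly q (real (Suc i)))
      = - real (Suc n) * ((-1) ^ i * real (n choose i) * poly q (1 + real i))"
      by (simp add: algebra_simps del: binomial_Suc_Suc)
  qed
  also have "\<dots> = 0"
    by (simp only: sum_distrib_left[symmetric] shift mult_zero_right)
  finally have "(\<Sum>i\<le>Suc n. (-1) ^ i * real (Suc n choose i) * (real i * poly q (real i))) = 0" .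
  moreover have "(\<Sum>i\<le>Suc n. (-1) ^ i * real (Suc n choose i) * poly p (real i))
      = a * (\<Sum>i\<le>Suc n. (-1) ^ i * real (Suc n choose i))
        + (\<Sum>i\<le>Suc n. (-1) ^ i * real (Suc n choose i) * (real i * poly q (real i)))"
    unfolding sum_distrib_left sum.distrib[symmetric] p
    by (rule sum.cong) (simp_all add: algebra_simps)
  ultimately show ?case using const by simp
qed

lemma sum_inverse_squares_le: "(\<Sum>j=1..m. 1 / (real j)\<^sup>2) \<le> 2"
proof -
  \<comment> \<open>The sharper bound 2 - 1/m makes the induction telescope: 1/(m+1)^2 is at most
    1/m - 1/(m+1).\<close>
  have "(\<Sum>j=1..Suc m. 1 / (real j)\<^sup>2) \<le> 2 - 1 / real (Suc m)" for m
  proof (induction m)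
    case (Suc m)
    have "1 / (real (Suc (Suc m)))\<^sup>2 \<le> 1 / (real (Suc m) * real (Suc (Suc m)))"
      by (intro divide_left_mono) (auto simp: power2_eq_square)
    also have "\<dots> = 1 / real (Suc m) - 1 / real (Suc (Suc m))"
      by (simp add: field_simps)
    finally show ?case using Suc by simp
  qed simp
  from this[of "m - 1"] show ?thesis
    by (cases m) (auto simp del: sum.cl_ivl_Suc intro: order.trans)
qed

lemma sum_inverse_squares_centered_le:
  "(\<Sum>i\<in>{..2 * m} - {m}. 1 / (real i - real m)\<^sup>2) \<le> 4"
proof -
  have split: "{..2 * m} - {m} = {..<m} \<union> {m<..2 * m}" by auto
  have "(\<Sum>i\<in>{..<m}. 1 / (real i - real m)\<^sup>2) = (\<Sum>j=1..m. 1 / (real j)\<^sup>2)"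
    by (rule sum.reindex_bij_witness[of _ "\<lambda>j. m - j" "\<lambda>i. m - i"])
       (auto simp: of_nat_diff power2_commute)
  moreover have "(\<Sum>i\<in>{m<..2 * m}. 1 / (real i - real m)\<^sup>2) = (\<Sum>j=1..m. 1 / (real j)\<^sup>2)"
    by (rule sum.reindex_bij_witness[of _ "\<lambda>j. m + j" "\<lambda>i. i - m"])
       (auto simp: of_nat_diff)
  moreover have "(\<Sum>i\<in>{..2 * m} - {m}. 1 / (real i - real m)\<^sup>2)
      = (\<Sum>i\<in>{..<m}. 1 / (real i - real m)\<^sup>2) + (\<Sum>i\<in>{m<..2 * m}. 1 / (real i - real m)\<^sup>2)"
    unfolding split by (rule sum.union_disjoint) auto
  ultimately show ?thesis using sum_inverse_squares_le[of m] by simp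
qed

text \<open>The constant 6 comes from the last estimate: with c in its place, the off-centre terms
  sum to at most 4 / (c - 1) times the central binomial coefficient, which beats the centre as soon
  as c > 5.\<close>

lemma degree_lower_bound:
  fixes p :: "real poly"
  assumes p0: "poly p 0 = 1" and p1: "poly p 1 = 0"
    and bounded: "\<And>i. i \<le> k \<Longrightarrow> \<bar>poly p (real i)\<bar> \<le> 1"
  shows "k < 6 * (degree p)\<^sup>2"
proof (rule ccontr)
  define m where "m = degree p"
  assume "\<not> ?thesis"
  then have k: "6 * m\<^sup>2 \<le> k" by (simp add: m_def)
  obtain q where q: "p = [:-1, 1:] * q"
    using p1 poly_eq_0_iff_dvd[of p 1] by (auto elim: dvdE)
  have "q \<noteq> 0" using q p0 by auto
  then have m: "m = Suc (degree q)"
    unfolding m_def q by (subst degree_mult_eq) auto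
  \<comment> \<open>The inner polynomial is 6 (X - m)^2. It sends the nodes 0, ..., 2m to the
    integers 6 j^2 with j \<le> m, all in the range where p is bounded, and makes the degree 2 (m -
    1).\<close>
  define s where "s = q \<circ>\<^sub>p [:6 * (real m)\<^sup>2, - 12 * real m, 6:]"
  have "degree s < 2 * m"
    unfolding s_def degree_pcompose by (simp add: m)
  then have zero: "(\<Sum>i\<le>2 * m. (-1) ^ i * real (2 * m choose i) * poly s (real i)) = 0"
    by (rule sum_alternating_binomial_poly)
  define y where "y i = 6 * (real i - real m)\<^sup>2" for i
  have poly_s: "poly s (real i) = poly q (y i)" for i
    unfolding s_def poly_pcompose y_def by (simp add: power2_eq_square algebra_simps)
  have "poly q 0 = - 1" using p0 q by simp
  then have sm: "poly s (real m) = - 1" by (simp add: poly_s y_def)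
  have summand: "\<bar>(-1) ^ i * real (2 * m choose i) * poly s (real i)\<bar>
      \<le> real (2 * m choose m) * (1 / 5 * (1 / (real i - real m)\<^sup>2))" if i: "i \<in> {..2 * m} - {m}" for i
  proof -
    define j where "j = nat \<bar>int i - int m\<bar>"
    have j: "1 \<le> j" "j \<le> m" using i by (auto simp: j_def)
    have ij: "(real i - real m)\<^sup>2 = (real j)\<^sup>2"
    proof -
      have "real j = \<bar>real i - real m\<bar>" unfolding j_def by simp
      then show ?thesis by simp
    qed
    have "6 * j\<^sup>2 \<le> k" by (rule order.trans[OF _ k]) (simp add: j power_mono)
    from bounded[OF this] have "\<bar>poly p (y i)\<bar> \<le> 1" by (simp add: y_def ij)
    moreover have "poly p (y i) = (y i - 1) * poly q (y i)" by (simp add: q algebra_simps)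
    ultimately have p_le: "\<bar>y i - 1\<bar> * \<bar>poly q (y i)\<bar> \<le> 1" by (simp add: abs_mult)
    have j2: "1 \<le> (real j)\<^sup>2" using j(1) by simp
    \<comment> \<open>Here 6 j^2 - 1 \<ge> 5 j^2, as j \<ge> 1; dividing by X - 1 thus gains
      quadratic decay away from the centre.\<close>
    then have "5 * (real j)\<^sup>2 * \<bar>poly q (y i)\<bar> \<le> \<bar>y i - 1\<bar> * \<bar>poly q (y i)\<bar>"
      by (intro mult_right_mono) (auto simp: y_def ij)
    with p_le have "\<bar>poly q (y i)\<bar> * (5 * (real j)\<^sup>2) \<le> 1" by (simp add: mult.commute)
    moreover have "0 < 5 * (real j)\<^sup>2" using j2 by linarith
    ultimately have "\<bar>poly q (y i)\<bar> \<le> 1 / (5 * (real j)\<^sup>2)" by (simp only: pos_le_divide_eq)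
    then have "\<bar>poly s (real i)\<bar> \<le> 1 / 5 * (1 / (real i - real m)\<^sup>2)"
      by (simp add: poly_s ij)
    moreover have "real (2 * m choose i) \<le> real (2 * m choose m)"
      using binomial_maximum[of "2 * m" i] by simp
    ultimately have "real (2 * m choose i) * \<bar>poly s (real i)\<bar>
        \<le> real (2 * m choose m) * (1 / 5 * (1 / (real i - real m)\<^sup>2))"
      by (intro mult_mono) auto
    then show ?thesis by (simp add: abs_mult power_abs)
  qed
  have "real (2 * m choose m) = \<bar>(-1) ^ m * real (2 * m choose m) * poly s (real m)\<bar>"
    by (simp add: sm abs_mult power_abs)
  also have "\<dots> = \<bar>\<Sum>i\<in>{..2 * m} - {m}. (-1) ^ i * real (2 * m choose i) * poly s (real i)\<bar>"
  proof -
    have "(\<Sum>i\<le>2 * m. (-1) ^ i * real (2 * m choose i) * poly s (real i))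
      = (-1) ^ m * real (2 * m choose m) * poly s (real m)
        + (\<Sum>i\<in>{..2 * m} - {m}. (-1) ^ i * real (2 * m choose i) * poly s (real i))"
      by (rule sum.remove) auto
    then show ?thesis using zero by linarith
  qed
  also have "\<dots> \<le> (\<Sum>i\<in>{..2 * m} - {m}. real (2 * m choose m) * (1 / 5 * (1 / (real i - real m)\<^sup>2)))"
    by (rule order.trans[OF sum_abs sum_mono]) (rule summand)
  also have "\<dots> = real (2 * m choose m) * (1 / 5 * (\<Sum>i\<in>{..2 * m} - {m}. 1 / (real i - real m)\<^sup>2))"
    by (simp only: sum_distrib_left)
  also have "\<dots> \<le> real (2 * m choose m) * (1 / 5 * 4)"
    using sum_inverse_squares_centered_le[of m] by (intro mult_left_mono) auto
  also have "\<dots> < real (2 * m choose m)"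
    by simp
  finally show False by simp
qed

section \<open>Real functions of low degree on a power set\<close>

text \<open>The span of the monomials of degree at most \<open>d\<close>, a set \<open>A\<close>
  standing for its 0/1 indicator vector. The inductive form lets linear statements be checked on
  monomials, and the free element type allows whole blocks as variables.\<close>

inductive low_degree :: "nat \<Rightarrow> ('a set \<Rightarrow> real) \<Rightarrow> bool" for d where
  monomial: "finite S \<Longrightarrow> card S \<le> d \<Longrightarrow> low_degree d (\<lambda>A. of_bool (S \<subseteq> A))"
| scale: "low_degree d g \<Longrightarrow> low_degree d (\<lambda>A. r * g A)"
| add: "low_degree d g \<Longrightarrow> low_degree d h \<Longrightarrow> low_degree d (\<lambda>A. g A + h A)"

lemma low_degree_const: "low_degree d (\<lambda>A. r)"
  using low_degree.scale[OF low_degree.monomial[of "{}" d], of r] by simp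

lemma low_degree_mono: "low_degree d g \<Longrightarrow> d \<le> e \<Longrightarrow> low_degree e g"
  by (induction rule: low_degree.induct) (auto intro: low_degree.intros)

lemma low_degree_sum:
  "finite I \<Longrightarrow> (\<And>i. i \<in> I \<Longrightarrow> low_degree d (g i)) \<Longrightarrow> low_degree d (\<lambda>A. \<Sum>i\<in>I. g i A)"
  by (induction rule: finite_induct) (auto intro: low_degree.intros low_degree_const)

lemma low_degree_mult_member:
  "low_degree d g \<Longrightarrow> low_degree (Suc d) (\<lambda>A. of_bool (a \<in> A) * g A)"
proof (induction rule: low_degree.induct)
  case (monomial S)
  have "low_degree (Suc d) (\<lambda>A. of_bool (insert a S \<subseteq> A))"
    using monomial by (intro low_degree.monomial) (auto simp: card_insert_if)
  then show ?case by (simp add: of_bool_conj)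
next
  case (scale g r)
  from low_degree.scale[OF this(2), of r] show ?case by (simp add: mult.left_commute)
next
  case (add g h)
  from low_degree.add[OF add(3,4)] show ?case by (simp add: distrib_left)
qed

text \<open>Each factor is a constant, a variable or a negated variable, so it raises the degree by
  at most one.\<close>

lemma low_degree_prod_literals:
  assumes "finite S"
    and "\<And>i. i \<in> S \<Longrightarrow> \<exists>a b. (\<forall>A. h A i = b) \<or> (\<forall>A. h A i = (b \<noteq> (a \<in> A)))"
  shows "low_degree (card S) (\<lambda>A. \<Prod>i\<in>S. of_bool (h A i))"
  using assms
proof (induction rule: finite_induct)
  case empty
  then show ?case by (simp add: low_degree_const)
next
  case (insert i S)
  let ?g = "\<lambda>A. \<Prod>i\<in>S. of_bool (h A i) :: real"
  have g: "low_degree (card S) ?g" using insert by blast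
  then have g': "low_degree (Suc (card S)) ?g" by (rule low_degree_mono) simp
  obtain a b where "(\<forall>A. h A i = b) \<or> (\<forall>A. h A i = (b \<noteq> (a \<in> A)))"
    using insert.prems[of i] by auto
  then consider "\<forall>A. h A i = b" | "\<forall>A. h A i = (a \<in> A)" | "\<forall>A. h A i = (a \<notin> A)"
    by (cases b) auto
  then have "low_degree (Suc (card S)) (\<lambda>A. of_bool (h A i) * ?g A)"
  proof cases
    case 1
    then show ?thesis using low_degree.scale[OF g', of "of_bool b"] by simp
  next
    case 2
    then show ?thesis using low_degree_mult_member[OF g, of a] by simp
  next
    case 3
    \<comment> \<open>A negated variable is 1 - x.\<close>
    have "low_degree (Suc (card S)) (\<lambda>A. ?g A + (- 1) * (of_bool (a \<in> A) * ?g A))"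
      by (intro low_degree.intros g' low_degree_mult_member g)
    moreover have "of_bool (h A i) * ?g A = ?g A + (- 1) * (of_bool (a \<in> A) * ?g A)" for A
      using 3 by simp
    ultimately show ?thesis by simp
  qed
  then show ?case using insert.hyps by simp
qed

text \<open>For \<open>a\<close> in \<open>A\<close> outside \<open>S\<close>, the terms of T and T
  \<union> {a} cancel: the sign changes, the condition on \<open>S\<close> does not.\<close>

lemma sum_alternating_superset:
  assumes "finite A" "\<not> A \<subseteq> S"
  shows "(\<Sum>T\<in>Pow A. (-1) ^ card T * of_bool (S \<subseteq> T) :: real) = 0"
proof -
  obtain a where a: "a \<in> A" "a \<notin> S" using assms by auto
  define A' where "A' = A - {a}"
  have A: "A = insert a A'" "a \<notin> A'" "finite A'" using a assms by (auto simp: A'_def)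
  have "(\<Sum>T\<in>Pow A. (-1) ^ card T * of_bool (S \<subseteq> T) :: real)
      = (\<Sum>T\<in>Pow A'. (-1) ^ card T * of_bool (S \<subseteq> T))
        + (\<Sum>T\<in>insert a ` Pow A'. (-1) ^ card T * of_bool (S \<subseteq> T))"
    unfolding A(1) Pow_insert using A by (intro sum.union_disjoint) auto
  also have "(\<Sum>T\<in>insert a ` Pow A'. (-1) ^ card T * of_bool (S \<subseteq> T) :: real)
      = (\<Sum>T\<in>Pow A'. (-1) ^ card (insert a T) * of_bool (S \<subseteq> insert a T))"
    using A by (subst sum.reindex) (auto simp: inj_on_def insert_ident)
  also have "\<dots> = (\<Sum>T\<in>Pow A'. - ((-1) ^ card T * of_bool (S \<subseteq> T)))"
  proof (rule sum.cong[OF refl])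
    fix T assume T: "T \<in> Pow A'"
    then have "finite T" "a \<notin> T" using A finite_subset by auto
    moreover have "S \<subseteq> insert a T \<longleftrightarrow> S \<subseteq> T" using a by auto
    ultimately show "(-1) ^ card (insert a T) * of_bool (S \<subseteq> insert a T)
        = - ((-1) ^ card T * of_bool (S \<subseteq> T) :: real)" by simp
  qed
  finally show ?thesis by (simp add: sum_negf)
qed

text \<open>Up to sign, the sum is the coefficient of the monomial \<open>A\<close> given by Moebius
  inversion; a set of at most \<open>d\<close> elements cannot contain \<open>A\<close>.\<close>

lemma low_degree_alternating_sum:
  assumes "low_degree d g" "finite A" "d < card A"
  shows "(\<Sum>T\<in>Pow A. (-1) ^ card T * g T) = 0"
  using assms(1)
proof (induction rule: low_degree.induct)
  case (monomial S)
  then have "\<not> A \<subseteq> S" using assms(3) card_mono[of S A] by auto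
  then show ?case using assms(2) by (intro sum_alternating_superset)
next
  case (scale g r)
  then show ?case by (simp add: mult.left_commute flip: sum_distrib_left)
next
  case (add g h)
  then show ?case by (simp add: distrib_left sum.distrib)
qed

text \<open>Only the term of \<open>A\<close> itself survives in the alternating sum, which is
  therefore nonzero.\<close>

lemma low_degree_minimal_nonzero:
  assumes "low_degree d g" "finite A" "g A \<noteq> 0" and zero: "\<And>T. T \<subset> A \<Longrightarrow> g T = 0"
  shows "card A \<le> d"
proof (rule ccontr)
  assume "\<not> card A \<le> d"
  then have "(\<Sum>T\<in>Pow A. (-1) ^ card T * g T) = 0"
    using assms by (intro low_degree_alternating_sum) auto
  moreover have "(\<Sum>T\<in>Pow A. (-1) ^ card T * g T) = (\<Sum>T\<in>{A}. (-1) ^ card T * g T)"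
    using assms(2) zero by (intro sum.mono_neutral_right) auto
  ultimately show False using assms(3) by simp
qed

section \<open>Symmetrization: averages over subsets of a given size\<close>

lemma card_supersets:
  assumes "finite U" "S \<subseteq> U" "card S \<le> t"
  shows "card {A. A \<subseteq> U \<and> card A = t \<and> S \<subseteq> A} = (card U - card S) choose (t - card S)"
proof -
  have fin: "finite S" using assms finite_subset by blast
  have "bij_betw (\<lambda>A. A - S) {A. A \<subseteq> U \<and> card A = t \<and> S \<subseteq> A}
      {B. B \<subseteq> U - S \<and> card B = t - card S}"
  proof (rule bij_betw_byWitness[where f' = "\<lambda>B. B \<union> S"])
    show "(\<lambda>B. B \<union> S) ` {B. B \<subseteq> U - S \<and> card B = t - card S}
        \<subseteq> {A. A \<subseteq> U \<and> card A = t \<and> S \<subseteq> A}"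
    proof safe
      fix B assume B: "B \<subseteq> U - S" "card B = t - card S"
      then have "card (B \<union> S) = card B + card S"
        using assms fin by (intro card_Un_disjoint) (auto intro: finite_subset)
      then show "card (B \<union> S) = t" using B assms by simp
    qed (use assms in auto)
  qed (use fin in \<open>auto simp: card_Diff_subset\<close>)
  then have "card {A. A \<subseteq> U \<and> card A = t \<and> S \<subseteq> A}
      = card {B. B \<subseteq> U - S \<and> card B = t - card S}"
    by (rule bij_betw_same_card)
  also have "\<dots> = (card U - card S) choose (t - card S)"
    using assms fin by (subst n_subsets) (auto simp: card_Diff_subset)
  finally show ?thesis .
qed

text \<open>By linearity a monomial suffices. With s = |S| and k = |U|, its average over the
  t-subsets is C(k-s, t-s) / C(k, t) = C(t, s) / C(k, s), a polynomial in t of degree s.\<close>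

lemma low_degree_symmetrization:
  fixes U :: "'a set"
  assumes "low_degree d g" "finite U"
  shows "\<exists>p. degree p \<le> d \<and> (\<forall>t\<le>card U. poly p (real t)
    = (\<Sum>A | A \<subseteq> U \<and> card A = t. g A) / real (card U choose t))"
  using assms(1)
proof (induction rule: low_degree.induct)
  case (monomial S)
  show ?case
  proof (cases "S \<subseteq> U")
    case False
    then have "(\<Sum>A | A \<subseteq> U \<and> card A = t. of_bool (S \<subseteq> A) :: real) = 0" for t
      by (intro sum.neutral) auto
    then show ?thesis by (intro exI[of _ 0]) auto
  next
    case True
    let ?s = "card S" and ?k = "card U"
    have sk: "?s \<le> ?k" using True assms card_mono by blast
    \<comment> \<open>The product is the falling factorial of length s, so p(t) = C(t, s) / C(k, s);
      it vanishes for t < s, as the average does.\<close>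
    define p where "p = smult (1 / (fact ?s * real (?k choose ?s))) (\<Prod>i<?s. [:- real i, 1:])"
    have "degree p \<le> degree (\<Prod>i<?s. [:- real i, 1:])"
      unfolding p_def by (rule degree_smult_le)
    also have "\<dots> = ?s"
      by (subst degree_prod_eq_sum_degree) auto
    finally have "degree p \<le> d" using monomial by simp
    moreover have "poly p (real t)
        = (\<Sum>A | A \<subseteq> U \<and> card A = t. of_bool (S \<subseteq> A)) / real (?k choose t)" if t: "t \<le> ?k" for t
    proof -
      have "poly p (real t) = real (t choose ?s) / real (?k choose ?s)"
        by (simp add: p_def poly_prod binomial_gbinomial gbinomial_prod_rev atLeast0LessThan)
      moreover have "(\<Sum>A | A \<subseteq> U \<and> card A = t. of_bool (S \<subseteq> A) :: real)
          = real (card {A. A \<subseteq> U \<and> card A = t \<and> S \<subseteq> A})"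
      proof -
        have "{A. A \<subseteq> U \<and> card A = t} \<inter> {A. S \<subseteq> A} = {A. A \<subseteq> U \<and> card A = t \<and> S \<subseteq> A}"
          by auto
        then show ?thesis using assms(2) by (simp add: sum_of_bool_eq)
      qed
      moreover have "real (t choose ?s) / real (?k choose ?s)
          = real (card {A. A \<subseteq> U \<and> card A = t \<and> S \<subseteq> A}) / real (?k choose t)"
      proof (cases "?s \<le> t")
        case True
        have "real (?k choose t) * real (t choose ?s)
            = real (?k choose ?s) * real ((?k - ?s) choose (t - ?s))"
          using choose_mult[OF True t] by (metis of_nat_mult)
        then show ?thesis
          using card_supersets[OF assms(2) \<open>S \<subseteq> U\<close> True] t sk
          by (simp add: frac_eq_eq mult.commute)
      next
        case False
        have "{A. A \<subseteq> U \<and> card A = t \<and> S \<subseteq> A} = {}"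
          using False assms(2) card_mono[of _ S] finite_subset by blast
        then show ?thesis using False by (simp add: binomial_eq_0 del: Collect_empty_eq)
      qed
      ultimately show ?thesis by simp
    qed
    ultimately show ?thesis by blast
  qed
next
  case (scale g r)
  then obtain p where "degree p \<le> d"
    "\<forall>t\<le>card U. poly p (real t) = (\<Sum>A | A \<subseteq> U \<and> card A = t. g A) / real (card U choose t)"
    by blast
  then show ?case
    by (intro exI[of _ "smult r p"]) (auto simp flip: sum_distrib_left)
next
  case (add g h)
  then obtain p q where "degree p \<le> d" "degree q \<le> d"
    "\<forall>t\<le>card U. poly p (real t) = (\<Sum>A | A \<subseteq> U \<and> card A = t. g A) / real (card U choose t)"
    "\<forall>t\<le>card U. poly q (real t) = (\<Sum>A | A \<subseteq> U \<and> card A = t. h A) / real (card U choose t)"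
    by blast
  then show ?case
    by (intro exI[of _ "p + q"]) (auto simp: degree_add_le sum.distrib add_divide_distrib)
qed

section \<open>Bounded polynomials of certificate functions\<close>

lemma finite_cube: "finite (cube n)"
  unfolding cube_def by (intro finite_PiE) auto

lemma flip_in_cube: "x \<in> cube n \<Longrightarrow> B \<subseteq> {..<n} \<Longrightarrow> flip B x \<in> cube n"
  by (auto simp: cube_def PiE_def extensional_def flip_def)

text \<open>The indicator of the point \<open>z\<close> is a bounded representation. Its existence
  ensures that the \<open>LEAST\<close> in \<open>bounded_deg\<close> is attained.\<close>

lemma represents_cert_fun_exists:
  assumes f: "partial_boolfun n f" and z: "z \<in> dom f"
  shows "\<exists>c. represents n c (cert_fun f z)"
proof -
  define Z where "Z = {i. i < n \<and> z i}"
  \<comment> \<open>The coefficients of the product of x_i over \<open>Z\<close> and 1 - x_i off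
    \<open>Z\<close>: a superset S of \<open>Z\<close> gets the sign (-1)^|S - Z|.\<close>
  define c :: "nat set \<Rightarrow> real" where "c S = (-1) ^ card Z * ((-1) ^ card S * of_bool (Z \<subseteq> S))" for S
  have eval: "ml_eval n c x = of_bool (x = z)" if x: "x \<in> cube n" for x
  proof -
    define X where "X = {i. i < n \<and> x i}"
    have fin: "finite X" by (simp add: X_def)
    have prod: "(\<Prod>i\<in>S. of_bool (x i) :: real) = of_bool (S \<subseteq> X)" if "S \<in> Pow {..<n}" for S
    proof -
      have "finite S" using that finite_subset by blast
      moreover have "(\<forall>i\<in>S. x i) \<longleftrightarrow> S \<subseteq> X" using that by (auto simp: X_def)
      ultimately show ?thesis by (auto simp: of_bool_def prod_zero_iff)
    qed
    have "ml_eval n c x = (\<Sum>S\<in>Pow {..<n}. c S * of_bool (S \<subseteq> X))"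
      unfolding ml_eval_def by (rule sum.cong) (auto simp: prod)
    also have "\<dots> = (\<Sum>S\<in>Pow X. c S)"
      by (rule sum.mono_neutral_cong_right) (auto simp: X_def)
    also have "\<dots> = (-1) ^ card Z * (\<Sum>S\<in>Pow X. (-1) ^ card S * of_bool (Z \<subseteq> S))"
      by (simp add: c_def sum_distrib_left)
    also have "\<dots> = of_bool (X = Z)"
    proof (cases "X \<subseteq> Z")
      case False
      then show ?thesis using sum_alternating_superset[OF fin False] by auto
    next
      case True
      then have "(\<Sum>S\<in>Pow X. (-1) ^ card S * of_bool (Z \<subseteq> S) :: real)
          = (\<Sum>S\<in>{X}. (-1) ^ card S * of_bool (Z \<subseteq> S))"
        using fin by (intro sum.mono_neutral_right) auto
      then show ?thesis using True by (auto simp flip: power_add mult_2)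
    qed
    also have "X = Z \<longleftrightarrow> x = z"
      using x f z unfolding partial_boolfun_def
      by (auto simp: X_def Z_def cube_def PiE_def extensional_def fun_eq_iff set_eq_iff)
    finally show ?thesis .
  qed
  have "x \<in> cube n" if "x \<in> dom (cert_fun f z)" for x
    using that f z by (auto simp: partial_boolfun_def cert_fun_def split: if_splits)
  then have "represents n c (cert_fun f z)"
    unfolding represents_def by (auto simp: eval cert_fun_def split: if_splits)
  then show ?thesis by blast
qed

lemma represents_eval: "represents n c f \<Longrightarrow> f x = Some b \<Longrightarrow> ml_eval n c x = of_bool b"
  by (auto simp: represents_def dom_def)

lemma cert_polynomial:
  assumes f: "partial_boolfun n f" and z: "z \<in> dom f"
  obtains c where "represents n c (cert_fun f z)"
    and "ml_degree n c \<le> cert_measure (bounded_deg n) f"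
proof -
  have "\<exists>c. represents n c (cert_fun f z) \<and> ml_degree n c = bounded_deg n (cert_fun f z)"
    unfolding bounded_deg_def
    by (rule LeastI_ex) (use represents_cert_fun_exists[OF f z] in auto)
  then obtain c where c: "represents n c (cert_fun f z)"
    "ml_degree n c = bounded_deg n (cert_fun f z)" by blast
  have "finite (dom f)"
    using f finite_cube[of n] finite_subset by (auto simp: partial_boolfun_def)
  then have "bounded_deg n (cert_fun f z) \<le> cert_measure (bounded_deg n) f"
    unfolding cert_measure_def using z by (intro cSUP_upper) auto
  with c show ?thesis by (intro that) auto
qed

lemma card_le_ml_degree:
  assumes "S \<subseteq> {..<n}" "c S \<noteq> 0"
  shows "card S \<le> ml_degree n c"
proof -
  have "finite {card S | S. S \<subseteq> {..<n} \<and> c S \<noteq> 0}"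
    by (rule finite_subset[of _ "card ` Pow {..<n}"]) auto
  then show ?thesis
    unfolding ml_degree_def using assms by (intro cSup_upper) auto
qed

text \<open>Substituting constants or literals for the variables does not raise the degree. This
  covers flipping single coordinates as well as disjoint blocks.\<close>

lemma low_degree_ml_eval:
  assumes "ml_degree n c \<le> d"
    and "\<And>i. \<exists>a b. (\<forall>A. h A i = b) \<or> (\<forall>A. h A i = (b \<noteq> (a \<in> A)))"
  shows "low_degree d (\<lambda>A. ml_eval n c (h A))"
  unfolding ml_eval_def
proof (rule low_degree_sum)
  fix S assume S: "S \<in> Pow {..<n}"
  show "low_degree d (\<lambda>A. c S * (\<Prod>i\<in>S. of_bool (h A i)))"
  proof (cases "c S = 0")
    case True
    then show ?thesis by (simp add: low_degree_const)
  next
    case False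
    then have "card S \<le> d" using card_le_ml_degree[of S n c] S assms(1) by auto
    moreover have "low_degree (card S) (\<lambda>A. \<Prod>i\<in>S. of_bool (h A i))"
      using S assms(2) by (intro low_degree_prod_literals) (auto intro: finite_subset)
    ultimately show ?thesis by (intro low_degree.scale) (rule low_degree_mono)
  qed
qed simp

section \<open>Sensitive blocks and certificates bounded by the certificate degree\<close>

text \<open>Partial functions are allowed because values of the certificate function are used only
  at \<open>x\<close> and at flips of one block; at larger unions the bounds 0 and 1 on the
  polynomial suffice.\<close>

lemma card_sensitive_blocks_le:
  assumes f: "partial_boolfun n f" and x: "x \<in> dom f"
    and B: "\<B> \<subseteq> Pow {..<n}" "pairwise disjnt \<B>"
      "\<And>B. B \<in> \<B> \<Longrightarrow> flip B x \<in> dom f \<and> f (flip B x) \<noteq> f x"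
  shows "card \<B> \<le> 6 * (cert_measure (bounded_deg n) f)\<^sup>2"
proof (cases "card \<B> = 0")
  case False
  let ?d = "cert_measure (bounded_deg n) f"
  obtain c where c: "represents n c (cert_fun f x)" "ml_degree n c \<le> ?d"
    using cert_polynomial[OF f x] .
  have fin: "finite \<B>" using B(1) finite_subset by blast
  have xc: "x \<in> cube n" using f x by (auto simp: partial_boolfun_def)
  \<comment> \<open>Intersecting with \<open>\<B>\<close> keeps the flipped point in the cube for
    every \<open>A\<close>.\<close>
  define g where "g A = ml_eval n c (flip (\<Union>(A \<inter> \<B>)) x)" for A
  have "low_degree ?d g"
    unfolding g_def
  proof (rule low_degree_ml_eval[OF c(2)])
    fix i
    show "\<exists>a b. (\<forall>A. flip (\<Union>(A \<inter> \<B>)) x i = b) \<or> (\<forall>A. flip (\<Union>(A \<inter> \<B>)) x i = (b \<noteq> (a \<in> A)))"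
    proof (cases "i \<in> \<Union>\<B>")
      case False
      then have "flip (\<Union>(A \<inter> \<B>)) x i = x i" for A by (auto simp: flip_def)
      then show ?thesis by blast
    next
      case True
      then obtain B where "B \<in> \<B>" "i \<in> B" by blast
      \<comment> \<open>By disjointness \<open>B\<close> is the only block containing
        \<open>i\<close>, so bit \<open>i\<close> is a literal in the variable
        \<open>B\<close>.\<close>
      then have "i \<in> \<Union>(A \<inter> \<B>) \<longleftrightarrow> B \<in> A" for A
        using pairwiseD[OF B(2)] by (auto 4 3 simp: disjnt_iff)
      then have "flip (\<Union>(A \<inter> \<B>)) x i = (x i \<noteq> (B \<in> A))" for A by (simp add: flip_def)
      then show ?thesis by blast
    qed
  qed
  from low_degree_symmetrization[OF this fin] obtain p where p: "degree p \<le> ?d"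
    "\<And>t. t \<le> card \<B> \<Longrightarrow> poly p (real t)
      = (\<Sum>A | A \<subseteq> \<B> \<and> card A = t. g A) / real (card \<B> choose t)"
    by blast
  have g_range: "0 \<le> g A" "g A \<le> 1" for A
  proof -
    have "flip (\<Union>(A \<inter> \<B>)) x \<in> cube n" using B(1) by (intro flip_in_cube[OF xc]) auto
    then show "0 \<le> g A" "g A \<le> 1" using c(1) by (auto simp: represents_def g_def)
  qed
  have "card \<B> < 6 * (degree p)\<^sup>2"
  proof (rule degree_lower_bound)
    have "{A. A \<subseteq> \<B> \<and> card A = 0} = {{}}" using fin by (auto dest: finite_subset)
    then have "poly p 0 = g {}" using p(2)[of 0] by simp
    also have "\<dots> = 1"
      using represents_eval[OF c(1), of x True] by (simp add: g_def flip_def cert_fun_def)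
    finally show "poly p 0 = 1" .
  next
    have "g A = 0" if A: "A \<subseteq> \<B>" "card A = 1" for A
    proof -
      obtain B where "A = {B}" "B \<in> \<B>" using A by (auto simp: card_1_singleton_iff)
      then have "g A = ml_eval n c (flip B x)" by (simp add: g_def)
      moreover have "cert_fun f x (flip B x) = Some False"
        using B(3)[OF \<open>B \<in> \<B>\<close>] by (auto simp: cert_fun_def)
      ultimately show ?thesis using represents_eval[OF c(1), of "flip B x" False] by simp
    qed
    then have "(\<Sum>A | A \<subseteq> \<B> \<and> card A = 1. g A) = 0" by (intro sum.neutral) auto
    then show "poly p 1 = 0" using p(2)[of 1] False by simp
  next
    fix t assume t: "t \<le> card \<B>"
    let ?s = "\<Sum>A | A \<subseteq> \<B> \<and> card A = t. g A"
    have "?s \<le> (\<Sum>A | A \<subseteq> \<B> \<and> card A = t. 1)" by (intro sum_mono g_range)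
    then have "?s \<le> real (card \<B> choose t)" using fin by (simp add: n_subsets)
    moreover have "0 \<le> ?s" by (intro sum_nonneg g_range)
    ultimately show "\<bar>poly p (real t)\<bar> \<le> 1"
      using p(2)[OF t] t by (simp add: divide_le_eq)
  qed
  also have "\<dots> \<le> 6 * ?d\<^sup>2" using p(1) by (simp add: power_mono)
  finally show ?thesis by simp
qed simp

text \<open>The polynomial for the certificate function of \<open>y\<close> vanishes wherever the
  value of \<open>f\<close> is that of \<open>x\<close>. By totality, any flip of \<open>x\<close>
  at which it is nonzero therefore changes \<open>f\<close>.\<close>

lemma small_sensitive_block:
  assumes f: "total_boolfun n f" and x: "x \<in> cube n" and y: "y \<in> cube n" and "f y \<noteq> f x"
  obtains A where "A \<subseteq> {i. i < n \<and> x i \<noteq> y i}" "f (flip A x) \<noteq> f x"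
    "card A \<le> cert_measure (bounded_deg n) f"
proof -
  have pf: "partial_boolfun n f" and dom: "dom f = cube n"
    using f by (auto simp: total_boolfun_def partial_boolfun_def)
  let ?d = "cert_measure (bounded_deg n) f"
  obtain c where c: "represents n c (cert_fun f y)" "ml_degree n c \<le> ?d"
    using cert_polynomial[OF pf] y dom by metis
  define D where "D = {i. i < n \<and> x i \<noteq> y i}"
  define g where "g A = ml_eval n c (flip A x)" for A
  have "low_degree ?d g"
    unfolding g_def by (rule low_degree_ml_eval[OF c(2)]) (auto simp: flip_def)
  have "flip D x = y"
    using x y by (auto simp: flip_def D_def cube_def PiE_def extensional_def fun_eq_iff)
  then have "g D \<noteq> 0"
    using represents_eval[OF c(1), of y True] by (simp add: g_def cert_fun_def)
  have "finite {A. A \<subseteq> D \<and> g A \<noteq> 0}" "{A. A \<subseteq> D \<and> g A \<noteq> 0} \<noteq> {}"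
    using \<open>g D \<noteq> 0\<close> by (auto simp: D_def)
  \<comment> \<open>Minimality makes \<open>g\<close> vanish on all proper subsets of
    \<open>A\<close>, which bounds the size of \<open>A\<close> by the degree.\<close>
  from finite_has_minimal[OF this] obtain A where A: "A \<subseteq> D" "g A \<noteq> 0" and min: "\<And>T. T \<subseteq> D \<Longrightarrow> g T \<noteq> 0 \<Longrightarrow> T \<subseteq> A \<Longrightarrow> A = T"
    by auto
  have "card A \<le> ?d"
  proof (rule low_degree_minimal_nonzero[OF \<open>low_degree ?d g\<close> _ A(2)])
    show "finite A" using A(1) by (rule finite_subset) (simp add: D_def)
    show "g T = 0" if "T \<subset> A" for T using min[of T] that A(1) by blast
  qed
  moreover have "f (flip A x) \<noteq> f x"
  proof
    assume eq: "f (flip A x) = f x"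
    have "flip A x \<in> dom f" unfolding dom using A(1) by (intro flip_in_cube[OF x]) (auto simp: D_def)
    then have "cert_fun f y (flip A x) = Some False"
      using eq \<open>f y \<noteq> f x\<close> by (auto simp: cert_fun_def)
    then have "g A = 0" using represents_eval[OF c(1), of "flip A x" False] by (simp add: g_def)
    with A(2) show False by simp
  qed
  ultimately show ?thesis using A(1) that unfolding D_def by blast
qed

lemma block_sensitivity_le:
  assumes f: "partial_boolfun n f"
  shows "block_sensitivity n f \<le> 6 * (cert_measure (bounded_deg n) f)\<^sup>2"
proof (cases "dom f = {}")
  case False
  show ?thesis
    unfolding block_sensitivity_def
  proof (rule cSUP_least[OF False])
    fix x assume x: "x \<in> dom f"
    show "block_sensitivity_at n f x \<le> 6 * (cert_measure (bounded_deg n) f)\<^sup>2"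
      unfolding block_sensitivity_at_def
      \<comment> \<open>The empty family shows that the set of cardinalities is nonempty.\<close>
      by (rule cSup_least, blast intro: pairwise_empty) (auto intro!: card_sensitive_blocks_le[OF f x])
  qed
qed (simp add: block_sensitivity_def)

lemma certificate_complexity_at_le:
  assumes f: "total_boolfun n f" and x: "x \<in> cube n"
  shows "certificate_complexity_at n f x \<le> 6 * (cert_measure (bounded_deg n) f) ^ 3"
proof -
  let ?d = "cert_measure (bounded_deg n) f"
  have pf: "partial_boolfun n f" and dom: "dom f = cube n"
    using f by (auto simp: total_boolfun_def partial_boolfun_def)
  define F where "F = {\<B>. \<B> \<subseteq> Pow {..<n} \<and> pairwise disjnt \<B> \<and>
    (\<forall>B\<in>\<B>. f (flip B x) \<noteq> f x \<and> card B \<le> ?d)}"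
  have "finite F" by (rule finite_subset[of _ "Pow (Pow {..<n})"]) (auto simp: F_def)
  moreover have "{} \<in> F" by (simp add: F_def)
  ultimately obtain \<B> where "\<B> \<in> F" and max: "\<And>\<C>. \<C> \<in> F \<Longrightarrow> \<B> \<subseteq> \<C> \<Longrightarrow> \<B> = \<C>"
    using finite_has_maximal[of F] by blast
  then have B: "\<B> \<subseteq> Pow {..<n}" "pairwise disjnt \<B>"
    "\<And>B. B \<in> \<B> \<Longrightarrow> f (flip B x) \<noteq> f x" "\<And>B. B \<in> \<B> \<Longrightarrow> card B \<le> ?d"
    by (auto simp: F_def)
  have cert: "f y = f x" if y: "y \<in> dom f" and agree: "\<forall>i\<in>\<Union>\<B>. y i = x i" for y
  proof (rule ccontr)
    assume "f y \<noteq> f x"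
    then obtain A where A: "A \<subseteq> {i. i < n \<and> x i \<noteq> y i}" "f (flip A x) \<noteq> f x" "card A \<le> ?d"
      using small_sensitive_block[OF f x] y dom by metis
    have "A \<inter> \<Union>\<B> = {}" using A(1) agree by fastforce
    \<comment> \<open>Maximality forces \<open>A\<close> into \<open>\<B>\<close>; being disjoint
      from the union, it would be empty, and the empty block is not sensitive.\<close>
    then have "insert A \<B> \<in> F"
      using A B \<open>\<B> \<in> F\<close> by (auto simp: F_def pairwise_insert disjnt_def)
    with max have "A \<in> \<B>" by blast
    with \<open>A \<inter> \<Union>\<B> = {}\<close> have "A = {}" by blast
    with A(2) show False by (simp add: flip_def)
  qed
  have "\<Union>\<B> \<subseteq> {..<n}" using B(1) by blast
  with cert have "certificate_complexity_at n f x \<le> card (\<Union>\<B>)"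
    unfolding certificate_complexity_at_def by (intro Least_le) blast
  also have "\<dots> \<le> (\<Sum>B\<in>\<B>. card B)"
    by (rule card_Union_le_sum_card)
  also have "\<dots> \<le> card \<B> * ?d"
    using sum_bounded_above[of \<B> card ?d] B(4) by simp
  also have "card \<B> \<le> 6 * ?d\<^sup>2"
    using B x dom by (intro card_sensitive_blocks_le[OF pf]) (auto intro: flip_in_cube)
  finally show ?thesis by (simp add: power3_eq_cube power2_eq_square mult.assoc)
qed

lemma certificate_complexity_le:
  assumes f: "total_boolfun n f"
  shows "certificate_complexity n f \<le> 6 * (cert_measure (bounded_deg n) f) ^ 3"
proof (cases "dom f = {}")
  case False
  then show ?thesis
    unfolding certificate_complexity_def using f certificate_complexity_at_le[OF f]
    by (intro cSUP_least) (auto simp: total_boolfun_def)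
qed (simp add: certificate_complexity_def)

theorem theorem12:
  shows "(\<exists>K::real. K > 0 \<and> (\<forall>n f. partial_boolfun n f \<longrightarrow>
            real (block_sensitivity n f) \<le> K * real (cert_measure (bounded_deg n) f) ^ 2))
       \<and> (\<exists>K::real. K > 0 \<and> (\<forall>n f. total_boolfun n f \<longrightarrow>
            real (certificate_complexity n f) \<le> K * real (cert_measure (bounded_deg n) f) ^ 3))"
proof (intro conjI exI[of _ 6] allI impI)
  fix n f assume "partial_boolfun n f"
  then show "real (block_sensitivity n f) \<le> 6 * real (cert_measure (bounded_deg n) f) ^ 2"
    using of_nat_mono[OF block_sensitivity_le, where 'a = real] by simp
next
  fix n f assume "total_boolfun n f"
  then show "real (certificate_complexity n f) \<le> 6 * real (cert_measure (bounded_deg n) f) ^ 3"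
    using of_nat_mono[OF certificate_complexity_le, where 'a = real] by simp
qed simp_all

end
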